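(* Let $S$ be a semiring and $M$ an $S$-semimodule such that $(M,+)$ is a group. Then the semiring $S$ is completely primary if and only if the expectation semiring $S\widetilde{\oplus}M$ is completely primary.
   Context: A semiring is an algebraic structure $(S,+,\cdot,0,1)$ such that $(S,+,0)$ and $(S,\cdot,1)$ are commutative monoids, multiplication distributes over addition, and $s\cdot 0=0$ for all $s\in S$. An $S$-semimodule is a commutative monoid $(M,+,0_M)$ with a scalar multiplication $S\times M\to M$ such that for all $s,t\in S$ and $m,n\in M$: $s(m+n)=sm+sn$; $(s+t)m=sm+tm$; $(st)m=s(tm)$; $s0_M=0_M$; $0_S m=0_M$; $1m=m$. The expectation semiring $S\widetilde{\oplus}M$ is the set $S\times M$ with operations $(s_1,m_1)+(s_2,m_2)=(s_1+s_2,m_1+m_2)$ and $(s_1,m_1)\cdot(s_2,m_2)=(s_1s_2,s_1m_2+s_2m_1)$. An element $s$ of a semiring is a unit if $st=1$ for some $t$; it is nilpotent if $s^n=0$ for some positive integer $n$. A semiring is completely primary if each of its elements is either a unit or nilpotent. *)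

theory Defs
  imports "HOL-Algebra.Module"
begin

text \<open>
  The library locale \<^locale>\<open>semiring\<close> does not require multiplication to be commutative.
  The degenerate case \<open>\<one> = \<zero>\<close> is allowed.
\<close>

locale csemiring = semiring R + comm_monoid R for R (structure)

text \<open>
  Unlike in the library locale \<^locale>\<open>module\<close>, scalars come from a semiring and \<open>M\<close> is only an additive
  commutative monoid. As there, the fields \<open>mult\<close> and \<open>one\<close> of the record \<open>M\<close> carry no meaning.
\<close>

locale semimodule = S?: csemiring S + M?: abelian_monoid M for S (structure) and M (structure) +
  assumes smult_closed [simp, intro]:
      "\<lbrakk>s \<in> carrier S; m \<in> carrier M\<rbrakk> \<Longrightarrow> s \<odot>\<^bsub>M\<^esub> m \<in> carrier M"
    and smult_r_distr:
      "\<lbrakk>s \<in> carrier S; m \<in> carrier M; n \<in> carrier M\<rbrakk> \<Longrightarrow>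
        s \<odot>\<^bsub>M\<^esub> (m \<oplus>\<^bsub>M\<^esub> n) = s \<odot>\<^bsub>M\<^esub> m \<oplus>\<^bsub>M\<^esub> s \<odot>\<^bsub>M\<^esub> n"
    and smult_l_distr:
      "\<lbrakk>s \<in> carrier S; t \<in> carrier S; m \<in> carrier M\<rbrakk> \<Longrightarrow>
        (s \<oplus>\<^bsub>S\<^esub> t) \<odot>\<^bsub>M\<^esub> m = s \<odot>\<^bsub>M\<^esub> m \<oplus>\<^bsub>M\<^esub> t \<odot>\<^bsub>M\<^esub> m"
    and smult_assoc:
      "\<lbrakk>s \<in> carrier S; t \<in> carrier S; m \<in> carrier M\<rbrakk> \<Longrightarrow>
        (s \<otimes>\<^bsub>S\<^esub> t) \<odot>\<^bsub>M\<^esub> m = s \<odot>\<^bsub>M\<^esub> (t \<odot>\<^bsub>M\<^esub> m)"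
    and smult_r_null [simp]: "s \<in> carrier S \<Longrightarrow> s \<odot>\<^bsub>M\<^esub> \<zero>\<^bsub>M\<^esub> = \<zero>\<^bsub>M\<^esub>"
    and smult_l_null [simp]: "m \<in> carrier M \<Longrightarrow> \<zero>\<^bsub>S\<^esub> \<odot>\<^bsub>M\<^esub> m = \<zero>\<^bsub>M\<^esub>"
    and smult_one [simp]: "m \<in> carrier M \<Longrightarrow> \<one>\<^bsub>S\<^esub> \<odot>\<^bsub>M\<^esub> m = m"

definition expectation_semiring ::
    "('a, 'r) ring_scheme \<Rightarrow> ('a, 'b, 'm) module_scheme \<Rightarrow> ('a \<times> 'b) ring" where
  "expectation_semiring S M =
    \<lparr> carrier = carrier S \<times> carrier M,
      mult = (\<lambda>(s\<^sub>1, m\<^sub>1) (s\<^sub>2, m\<^sub>2). (s\<^sub>1 \<otimes>\<^bsub>S\<^esub> s\<^sub>2, s\<^sub>1 \<odot>\<^bsub>M\<^esub> m\<^sub>2 \<oplus>\<^bsub>M\<^esub> s\<^sub>2 \<odot>\<^bsub>M\<^esub> m\<^sub>1)),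
      one = (\<one>\<^bsub>S\<^esub>, \<zero>\<^bsub>M\<^esub>),
      zero = (\<zero>\<^bsub>S\<^esub>, \<zero>\<^bsub>M\<^esub>),
      add = (\<lambda>(s\<^sub>1, m\<^sub>1) (s\<^sub>2, m\<^sub>2). (s\<^sub>1 \<oplus>\<^bsub>S\<^esub> s\<^sub>2, m\<^sub>1 \<oplus>\<^bsub>M\<^esub> m\<^sub>2)) \<rparr>"

definition nilpotent :: "('a, 'r) ring_scheme \<Rightarrow> 'a \<Rightarrow> bool" where
  "nilpotent R s \<longleftrightarrow> s \<in> carrier R \<and> (\<exists>n::nat. n > 0 \<and> s [^]\<^bsub>R\<^esub> n = \<zero>\<^bsub>R\<^esub>)"

locale completely_primary = csemiring R for R (structure) +
  assumes unit_or_nilpotent: "s \<in> carrier R \<Longrightarrow> s \<in> Units R \<or> nilpotent R s"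

lemma (in semimodule) csemiring_expectation_semiring:
  "csemiring (expectation_semiring S M)"
proof -
  let ?E = "expectation_semiring S M"
  have 1: "comm_monoid (add_monoid ?E)"
    by (rule comm_monoidI)
      (auto simp: expectation_semiring_def S.a_ac M.a_ac)
  have 2: "comm_monoid ?E"
    by (rule comm_monoidI)
      (auto simp: expectation_semiring_def S.m_ac M.a_ac smult_r_distr smult_assoc[symmetric])
  have "semiring ?E"
    by (intro semiring.intro abelian_monoid.intro 1 comm_monoid.axioms(1)[OF 2] semiring_axioms.intro)
      (auto simp: expectation_semiring_def S.l_distr S.r_distr smult_r_distr smult_l_distr M.a_ac)
  then show ?thesis using 2 by (rule csemiring.intro)
qed

end

theory Submission
  imports Defs
begin

text \<open>
  Being a unit and being nilpotent are both decided by the first component: \<open>(s, m)\<close> is a unit,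
  respectively nilpotent, in \<open>S \<oplus> M\<close> iff \<open>s\<close> is one in \<open>S\<close>. The projection \<open>(s, m) \<mapsto> s\<close> is
  a surjective semiring homomorphism, so one direction is immediate. Conversely, elements \<open>(0, x)\<close>
  have square zero, so nilpotency lifts from \<open>s\<close> to \<open>(s, m)\<close>; and if \<open>s t = 1\<close> then
  \<open>(t, - t t m)\<close> inverts \<open>(s, m)\<close>. The latter is where additive inverses in \<open>M\<close> enter.
  Hence "every element is a unit or nilpotent" holds in both semirings or in neither.
\<close>

context semimodule
begin

lemma expectation_semiring_simps:
  "carrier (expectation_semiring S M) = carrier S \<times> carrier M"
  "(s, m) \<otimes>\<^bsub>expectation_semiring S M\<^esub> (t, n) = (s \<otimes>\<^bsub>S\<^esub> t, s \<odot>\<^bsub>M\<^esub> n \<oplus>\<^bsub>M\<^esub> t \<odot>\<^bsub>M\<^esub> m)"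
  "\<one>\<^bsub>expectation_semiring S M\<^esub> = (\<one>\<^bsub>S\<^esub>, \<zero>\<^bsub>M\<^esub>)"
  "\<zero>\<^bsub>expectation_semiring S M\<^esub> = (\<zero>\<^bsub>S\<^esub>, \<zero>\<^bsub>M\<^esub>)"
  by (simp_all add: expectation_semiring_def)

lemma fst_expectation_pow:
  "fst ((s, m) [^]\<^bsub>expectation_semiring S M\<^esub> (n::nat)) = s [^]\<^bsub>S\<^esub> n"
proof (induction n)
  case (Suc n)
  then show ?case
    by (cases "(s, m) [^]\<^bsub>expectation_semiring S M\<^esub> n") (simp add: expectation_semiring_simps)
qed (simp add: expectation_semiring_simps)

text \<open>
  If \<open>s\<^sup>n = 0\<close>, then \<open>(s, m)\<^sup>n = (0, x)\<close> for some \<open>x\<close>, and squaring once more gives zero.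
\<close>

lemma nilpotent_expectation_iff:
  "nilpotent (expectation_semiring S M) (s, m) \<longleftrightarrow> nilpotent S s \<and> m \<in> carrier M"
proof
  assume "nilpotent (expectation_semiring S M) (s, m)"
  then show "nilpotent S s \<and> m \<in> carrier M"
    unfolding nilpotent_def
    by (metis fst_expectation_pow expectation_semiring_simps(1,4) fst_conv mem_Sigma_iff)
next
  let ?E = "expectation_semiring S M"
  interpret E: csemiring ?E by (rule csemiring_expectation_semiring)
  assume nil: "nilpotent S s \<and> m \<in> carrier M"
  then obtain n :: nat where n: "n > 0" "s [^]\<^bsub>S\<^esub> n = \<zero>\<^bsub>S\<^esub>"
    by (auto simp: nilpotent_def)
  have sm: "(s, m) \<in> carrier ?E"
    using nil by (simp add: nilpotent_def expectation_semiring_simps)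
  obtain x where x: "(s, m) [^]\<^bsub>?E\<^esub> n = (\<zero>\<^bsub>S\<^esub>, x)"
    using fst_expectation_pow[of s m n] n(2) by (metis prod.collapse)
  have "x \<in> carrier M"
    using E.nat_pow_closed[OF sm, of n] by (simp add: x expectation_semiring_simps)
  then have "(s, m) [^]\<^bsub>?E\<^esub> (n + n) = \<zero>\<^bsub>?E\<^esub>"
    by (simp add: E.nat_pow_mult[OF sm, symmetric] x expectation_semiring_simps)
  with sm n(1) show "nilpotent ?E (s, m)"
    unfolding nilpotent_def by (intro conjI exI[of _ "n + n"]) auto
qed

lemma Units_expectation_iff:
  assumes "group (add_monoid M)"
  shows "(s, m) \<in> Units (expectation_semiring S M) \<longleftrightarrow> s \<in> Units S \<and> m \<in> carrier M"
proof
  assume "(s, m) \<in> Units (expectation_semiring S M)"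
  then show "s \<in> Units S \<and> m \<in> carrier M"
    by (auto simp: Units_def expectation_semiring_simps)
next
  let ?E = "expectation_semiring S M"
  interpret E: csemiring ?E by (rule csemiring_expectation_semiring)
  assume "s \<in> Units S \<and> m \<in> carrier M"
  then obtain t where s: "s \<in> carrier S" and t: "t \<in> carrier S" "s \<otimes>\<^bsub>S\<^esub> t = \<one>\<^bsub>S\<^esub>"
    and m: "m \<in> carrier M"
    by (auto simp: Units_def)
  \<comment> \<open>\<open>y\<close> is the additive inverse of \<open>t m\<close>, so that \<open>t y = - t t m\<close>.\<close>
  obtain y where y: "y \<in> carrier M" "y \<oplus>\<^bsub>M\<^esub> t \<odot>\<^bsub>M\<^esub> m = \<zero>\<^bsub>M\<^esub>"
    using group.l_inv_ex[OF assms, of "t \<odot>\<^bsub>M\<^esub> m"] t(1) m by auto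
  have "s \<odot>\<^bsub>M\<^esub> (t \<odot>\<^bsub>M\<^esub> y) = y"
    using s t y(1) by (simp add: smult_assoc[symmetric])
  then have inv: "(s, m) \<otimes>\<^bsub>?E\<^esub> (t, t \<odot>\<^bsub>M\<^esub> y) = \<one>\<^bsub>?E\<^esub>"
    using t(2) y(2) by (simp add: expectation_semiring_simps)
  have "(s, m) \<in> carrier ?E" "(t, t \<odot>\<^bsub>M\<^esub> y) \<in> carrier ?E"
    using s t(1) m y(1) by (simp_all add: expectation_semiring_simps)
  with inv show "(s, m) \<in> Units ?E"
    unfolding Units_def using E.m_comm by force
qed

end

theorem proposition4p6:
  fixes S :: "('a, 'r) ring_scheme" and M :: "('a, 'b, 'm) module_scheme"
  assumes "semimodule S M"
    and "group (add_monoid M)"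
  shows "completely_primary S \<longleftrightarrow> completely_primary (expectation_semiring S M)"
proof -
  interpret semimodule S M by (rule assms(1))
  let ?E = "expectation_semiring S M"
  have "completely_primary ?E \<longleftrightarrow>
      (\<forall>s \<in> carrier S. \<forall>m \<in> carrier M. s \<in> Units S \<or> nilpotent S s)"
    unfolding completely_primary_def completely_primary_axioms_def
    by (auto simp: csemiring_expectation_semiring expectation_semiring_simps
        Units_expectation_iff[OF assms(2)] nilpotent_expectation_iff)
  also have "\<dots> \<longleftrightarrow> (\<forall>s \<in> carrier S. s \<in> Units S \<or> nilpotent S s)"
    using M.zero_closed by blast
  also have "\<dots> \<longleftrightarrow> completely_primary S"
    by (auto simp: completely_primary_def completely_primary_axioms_def S.csemiring_axioms)
  finally show ?thesis by simp
qed

end
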